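(* For every integer $d\ge 4$ there exists a bridgeless cubic graph $G$ whose defect $\operatorname{df}(G)$ equals $4$ and whose regular defect $\operatorname{rdf}(G)$ is at least $d$.
   Context: Graphs are finite and undirected; parallel edges and loops are permitted. A $3$-array of a cubic graph $G$ is a collection $\{M_1,M_2,M_3\}$ of three (not necessarily distinct) perfect matchings of $G$. An edge is uncovered by the $3$-array if it belongs to none of $M_1,M_2,M_3$. The defect $\operatorname{df}(G)$ of a bridgeless cubic graph $G$ is the minimum number of uncovered edges taken over all $3$-arrays of $G$. A $3$-array $\{M_1,M_2,M_3\}$ is regular if $M_1\cap M_2\cap M_3=\emptyset$. The regular defect $\operatorname{rdf}(G)$ is the minimum number of uncovered edges taken over all regular $3$-arrays of $G$. *)

theory Defs
  imports Main
begin

text \<open>Multigraphs: parallel edges are distinct edges with the same set of ends; a loop is an edge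
  whose set of ends is a singleton.\<close>

record ('v, 'e) multigraph =
  verts :: "'v set"
  edges :: "'e set"
  ends :: "'e \<Rightarrow> 'v set"

definition finite_multigraph :: "('v, 'e) multigraph \<Rightarrow> bool" where
  "finite_multigraph G \<longleftrightarrow> finite (verts G) \<and> finite (edges G) \<and>
     (\<forall>e\<in>edges G. ends G e \<subseteq> verts G \<and> (card (ends G e) = 1 \<or> card (ends G e) = 2))"

text \<open>The degree of a vertex in the spanning subgraph with edge set \<open>F\<close>; loops count twice.\<close>

definition degree_in :: "('v, 'e) multigraph \<Rightarrow> 'e set \<Rightarrow> 'v \<Rightarrow> nat" where
  "degree_in G F v = card {e\<in>F. v \<in> ends G e} + card {e\<in>F. ends G e = {v}}"

definition cubic :: "('v, 'e) multigraph \<Rightarrow> bool" where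
  "cubic G \<longleftrightarrow> (\<forall>v\<in>verts G. degree_in G (edges G) v = 3)"

definition adjacent_via :: "('v, 'e) multigraph \<Rightarrow> 'e set \<Rightarrow> ('v \<times> 'v) set" where
  "adjacent_via G F = {(u, v). \<exists>e\<in>F. ends G e = {u, v}}"

text \<open>An edge is a bridge if it separates its ends; in particular a loop is never a bridge.\<close>

definition bridge :: "('v, 'e) multigraph \<Rightarrow> 'e \<Rightarrow> bool" where
  "bridge G e \<longleftrightarrow> e \<in> edges G \<and>
     (\<exists>u v. ends G e = {u, v} \<and> (u, v) \<notin> (adjacent_via G (edges G - {e}))\<^sup>*)"

definition bridgeless :: "('v, 'e) multigraph \<Rightarrow> bool" where
  "bridgeless G \<longleftrightarrow> (\<forall>e\<in>edges G. \<not> bridge G e)"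

text \<open>A perfect matching is (the edge set of) a spanning 1-regular subgraph, so it contains no
  loops.\<close>

definition perfect_matching :: "('v, 'e) multigraph \<Rightarrow> 'e set \<Rightarrow> bool" where
  "perfect_matching G M \<longleftrightarrow> M \<subseteq> edges G \<and> (\<forall>v\<in>verts G. degree_in G M v = 1)"

definition three_array ::
  "('v, 'e) multigraph \<Rightarrow> 'e set \<Rightarrow> 'e set \<Rightarrow> 'e set \<Rightarrow> bool" where
  "three_array G M1 M2 M3 \<longleftrightarrow>
     perfect_matching G M1 \<and> perfect_matching G M2 \<and> perfect_matching G M3"

definition regular_three_array ::
  "('v, 'e) multigraph \<Rightarrow> 'e set \<Rightarrow> 'e set \<Rightarrow> 'e set \<Rightarrow> bool" where
  "regular_three_array G M1 M2 M3 \<longleftrightarrow> three_array G M1 M2 M3 \<and> M1 \<inter> M2 \<inter> M3 = {}"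

definition uncovered ::
  "('v, 'e) multigraph \<Rightarrow> 'e set \<Rightarrow> 'e set \<Rightarrow> 'e set \<Rightarrow> 'e set" where
  "uncovered G M1 M2 M3 = {e\<in>edges G. e \<notin> M1 \<and> e \<notin> M2 \<and> e \<notin> M3}"

definition defect :: "('v, 'e) multigraph \<Rightarrow> nat" where
  "defect G = Min {card (uncovered G M1 M2 M3) | M1 M2 M3. three_array G M1 M2 M3}"

text \<open>Every bridgeless cubic graph has a 3-array, so the minimum above exists for such graphs. That
  it always has a regular one is the Fan--Raspaud conjecture; the value below is therefore
  meaningful only together with the existence of a regular 3-array.\<close>

definition regular_defect :: "('v, 'e) multigraph \<Rightarrow> nat" where
  "regular_defect G =
     Min {card (uncovered G M1 M2 M3) | M1 M2 M3. regular_three_array G M1 M2 M3}"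

end

theory Submission imports Defs begin

text \<open>Deleting two adjacent vertices \<open>s, t\<close> from the Petersen graph leaves a 4-pole whose
  3-edge-colourings give equal colours to the two dangling edges at \<open>s\<close>, and likewise at \<open>t\<close>. Arrange
  many copies of it in a chain and close the chain by a hub: two triangles joined by an edge \<open>h\<close>.
  The two edges entering a copy form a 3-edge-cut with \<open>h\<close>. If all edges of the copy are covered,
  they are covered exactly once, so the two entering edges have the same colour, and by parity
  each of the three matchings contains \<open>h\<close>. Hence a regular 3-array leaves an edge at every copy
  uncovered. If \<open>h\<close> is allowed in all three matchings, only the four edges adjacent to \<open>h\<close> remain
  uncovered; four is optimal because any triply covered edge has four uncovered neighbours.
  Since a bridge of a cubic graph lies in every perfect matching, a regular 3-array also certifies
  that the ring is bridgeless.\<close>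

section \<open>Cuts, perfect matchings and parity\<close>

definition cut :: "('v, 'e) multigraph \<Rightarrow> 'v set \<Rightarrow> 'e set" where
  "cut G S = {e\<in>edges G. ends G e \<inter> S \<noteq> {} \<and> \<not> ends G e \<subseteq> S}"

text \<open>Double counting, edge by edge: an edge of \<open>F\<close> inside \<open>S\<close>, loop
  or not, adds 2 to the degree sum; an edge leaving \<open>S\<close> adds 1 to the degree sum and 1
  to the cut; any other edge adds nothing.\<close>

lemma even_degree_sum_plus_cut:
  assumes "finite_multigraph G" "F \<subseteq> edges G" "finite S"
  shows "even ((\<Sum>v\<in>S. degree_in G F v) + card (cut G S \<inter> F))"
proof -
  have fin: "finite F"
    using assms unfolding finite_multigraph_def by (meson finite_subset)
  define t where "t e = (\<Sum>v\<in>S. of_bool (v \<in> ends G e) + of_bool (ends G e = {v}) :: nat)" for e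
  have deg: "degree_in G F v = (\<Sum>e\<in>F. of_bool (v \<in> ends G e) + of_bool (ends G e = {v}))" for v
    using fin by (simp add: degree_in_def sum.distrib of_bool_def sum.If_cases Int_def)
  have "(\<Sum>v\<in>S. degree_in G F v) = (\<Sum>e\<in>F. t e)"
    unfolding deg t_def by (rule sum.swap)
  moreover have "card (cut G S \<inter> F) = (\<Sum>e\<in>F. of_bool (e \<in> cut G S))"
    using fin by (simp add: of_bool_def sum.If_cases Int_commute)
  moreover have "even (t e + of_bool (e \<in> cut G S))" if "e \<in> F" for e
  proof -
    have e: "e \<in> edges G" "card (ends G e) = 1 \<or> card (ends G e) = 2"
      using assms that unfolding finite_multigraph_def by auto
    have t: "t e = card (S \<inter> ends G e) + card {v\<in>S. ends G e = {v}}"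
      using \<open>finite S\<close> by (simp add: t_def sum.distrib of_bool_def sum.If_cases Int_def)
    from e(2) show ?thesis
    proof
      assume "card (ends G e) = 1"
      then obtain x where x: "ends G e = {x}" by (auto simp: card_1_singleton_iff)
      have "{v\<in>S. {x} = {v}} = S \<inter> {x}" by auto
      then show ?thesis using x by (auto simp: t cut_def)
    next
      assume "card (ends G e) = 2"
      then obtain x y where xy: "ends G e = {x, y}" "x \<noteq> y" by (auto simp: card_2_iff)
      then have "{v\<in>S. ends G e = {v}} = {}" by auto
      then have "t e = card (S \<inter> {x, y})" by (simp only: t xy(1) card.empty add_0_right)
      then show ?thesis
        using xy e(1) by (cases "x \<in> S"; cases "y \<in> S") (simp_all add: cut_def)
    qed
  qed
  ultimately show ?thesis
    by (simp flip: sum.distrib add: dvd_sum)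
qed

text \<open>The degree sums over \<open>S\<close> are \<open>3 * card S\<close> for all edges and
  \<open>card S\<close> for \<open>M\<close>. These have the same parity, hence so do the two
  cuts.\<close>

lemma cubic_matching_cut_parity:
  assumes G: "finite_multigraph G" "cubic G" and M: "perfect_matching G M" and S: "S \<subseteq> verts G"
  shows "even (card (cut G S \<inter> M)) \<longleftrightarrow> even (card (cut G S))"
proof -
  have "finite S" using G(1) S unfolding finite_multigraph_def by (meson finite_subset)
  have "(\<Sum>v\<in>S. degree_in G (edges G) v) = (\<Sum>v\<in>S. 3)"
    by (rule sum.cong) (use G(2) S in \<open>auto simp: cubic_def\<close>)
  moreover have "(\<Sum>v\<in>S. degree_in G M v) = (\<Sum>v\<in>S. 1)"
    by (rule sum.cong) (use M S in \<open>auto simp: perfect_matching_def\<close>)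
  moreover have "cut G S \<inter> edges G = cut G S" by (auto simp: cut_def)
  ultimately show ?thesis
    using even_degree_sum_plus_cut[OF G(1) _ \<open>finite S\<close>, of "edges G"]
      even_degree_sum_plus_cut[OF G(1) _ \<open>finite S\<close>, of M] M
    by (simp add: perfect_matching_def)
qed

text \<open>The vertices reachable from one end of a bridge without using it have the bridge as
  their whole cut, and an odd cut meets every perfect matching.\<close>

lemma bridge_in_perfect_matching:
  assumes G: "finite_multigraph G" "cubic G" and M: "perfect_matching G M" and "bridge G e"
  shows "e \<in> M"
proof -
  obtain u v where e: "e \<in> edges G" "ends G e = {u, v}"
    and uv: "(u, v) \<notin> (adjacent_via G (edges G - {e}))\<^sup>*"
    using \<open>bridge G e\<close> unfolding bridge_def by blast
  define S where "S = {w. (u, w) \<in> (adjacent_via G (edges G - {e}))\<^sup>*}"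
  have "w \<in> verts G" if "(u, w) \<in> (adjacent_via G (edges G - {e}))\<^sup>*" for w
    using that
  proof induction
    case base
    then show ?case using G(1) e by (auto simp: finite_multigraph_def)
  next
    case (step y z)
    then show ?case using G(1) by (fastforce simp: finite_multigraph_def adjacent_via_def)
  qed
  then have S: "S \<subseteq> verts G" by (auto simp: S_def)
  have closed: "ends G f \<subseteq> S" if f: "f \<in> edges G" "f \<noteq> e" "ends G f \<inter> S \<noteq> {}" for f
  proof -
    obtain p where p: "p \<in> ends G f" "p \<in> S" using f(3) by blast
    have "q \<in> S" if "q \<in> ends G f" for q
    proof (cases "q = p")
      case False
      have "card (ends G f) = 1 \<or> card (ends G f) = 2"
        using G(1) f(1) by (auto simp: finite_multigraph_def)
      then have "ends G f = {p, q}"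
        using False p(1) that by (auto simp: card_1_singleton_iff card_2_iff)
      then have "(p, q) \<in> adjacent_via G (edges G - {e})"
        using f by (auto simp: adjacent_via_def)
      then show ?thesis
        using p(2) unfolding S_def by (auto intro: rtrancl_into_rtrancl)
    qed (use p in simp)
    then show ?thesis by blast
  qed
  have "u \<in> S" "v \<notin> S" using uv by (auto simp: S_def)
  then have cut: "cut G S = {e}"
    using e closed by (auto simp: cut_def)
  have "odd (card (cut G S \<inter> M))"
    using cubic_matching_cut_parity[OF G M S] cut by simp
  then show ?thesis unfolding cut by (cases "e \<in> M") auto
qed

lemma bridgeless_if_regular_three_array:
  assumes "finite_multigraph G" "cubic G" "regular_three_array G M1 M2 M3"
  shows "bridgeless G"
  using assms bridge_in_perfect_matching[OF assms(1,2)]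
  unfolding bridgeless_def regular_three_array_def three_array_def by blast

section \<open>Arrays with a triply covered edge\<close>

lemma degree_in_loopless:
  assumes "\<And>e. e \<in> F \<Longrightarrow> card (ends G e) = 2"
  shows "degree_in G F v = card {e\<in>F. v \<in> ends G e}"
proof -
  have "{e\<in>F. ends G e = {v}} = {}" using assms by force
  then show ?thesis by (simp only: degree_in_def card.empty add_0_right)
qed

text \<open>A common edge saturates both its ends in all three matchings, so none of them contains
  another edge there. Each end has two other edges, and without loops and parallel edges these four
  are distinct.\<close>

lemma irregular_three_array_uncovered:
  assumes G: "finite_multigraph G" "cubic G"
    and simple: "\<And>e. e \<in> edges G \<Longrightarrow> card (ends G e) = 2" "inj_on (ends G) (edges G)"
    and arr: "three_array G M1 M2 M3" and irr: "M1 \<inter> M2 \<inter> M3 \<noteq> {}"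
  shows "4 \<le> card (uncovered G M1 M2 M3)"
proof -
  obtain e where e: "e \<in> M1" "e \<in> M2" "e \<in> M3" using irr by blast
  have M: "perfect_matching G M1" "perfect_matching G M2" "perfect_matching G M3"
    using arr by (auto simp: three_array_def)
  then have eG: "e \<in> edges G" using e by (auto simp: perfect_matching_def)
  obtain u v where uv: "ends G e = {u, v}" "u \<noteq> v"
    using simple(1)[OF eG] by (auto simp: card_2_iff)
  then have vs: "u \<in> verts G" "v \<in> verts G"
    using G(1) eG by (auto simp: finite_multigraph_def)
  have finE: "finite (edges G)" using G(1) by (simp add: finite_multigraph_def)
  have deg: "degree_in G F w = card {f\<in>F. w \<in> ends G f}" if "F \<subseteq> edges G" for F w
    by (rule degree_in_loopless) (use simple(1) that in blast)
  define A where "A w = {f\<in>edges G. w \<in> ends G f} - {e}" for w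
  have cardA: "card (A w) = 2" and finA: "finite (A w)" if "w \<in> {u, v}" for w
  proof -
    have "card {f\<in>edges G. w \<in> ends G f} = 3"
      using G(2) that vs deg[of "edges G" w] by (auto simp: cubic_def)
    then show "card (A w) = 2" using that eG uv finE by (auto simp: A_def)
    show "finite (A w)" using finE by (simp add: A_def)
  qed
  have notin: "f \<notin> M" if "f \<in> A w" "w \<in> {u, v}" "perfect_matching G M" "e \<in> M" for f w M
  proof
    assume "f \<in> M"
    have "card {g\<in>M. w \<in> ends G g} = 1"
      using that vs deg[of M w] by (auto simp: perfect_matching_def)
    then obtain g where "{g\<in>M. w \<in> ends G g} = {g}" by (auto simp: card_1_singleton_iff)
    moreover have "e \<in> {g\<in>M. w \<in> ends G g}" "f \<in> {g\<in>M. w \<in> ends G g}"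
      using that uv \<open>f \<in> M\<close> by (auto simp: A_def)
    ultimately show False using that(1) by (auto simp: A_def)
  qed
  have "f = e" if "f \<in> edges G" "u \<in> ends G f" "v \<in> ends G f" for f
  proof -
    have "ends G f = {u, v}"
      using simple(1)[OF that(1)] that uv by (auto simp: card_2_iff)
    then show ?thesis using simple(2) uv eG that(1) by (auto simp: inj_on_def)
  qed
  then have "A u \<inter> A v = {}" by (auto simp: A_def)
  then have "card (A u \<union> A v) = 4" by (simp add: card_Un_disjoint cardA finA)
  moreover have "A u \<union> A v \<subseteq> uncovered G M1 M2 M3"
    using notin M e by (auto simp: uncovered_def A_def)
  moreover have "finite (uncovered G M1 M2 M3)" using finE by (simp add: uncovered_def)
  ultimately show ?thesis by (metis card_mono)
qed

section \<open>The ring and its incidences\<close>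

text \<open>The ring has \<open>m\<close> blocks. Block \<open>0\<close> (the hub) consists of the triangles \<open>2, 3, 4\<close> and
  \<open>5, 6, 7\<close> and the edge joining \<open>4\<close> to \<open>5\<close>; its vertex slots \<open>0, 1\<close> and edge slots \<open>0, 1, 2\<close>
  are void. Every other block is the Petersen graph minus two adjacent vertices \<open>s, t\<close>: \<open>2, 3\<close> are
  the remaining neighbours of \<open>s\<close> and \<open>6, 7\<close> those of \<open>t\<close>. The edges in slots \<open>10, 11\<close> join
  \<open>6, 7\<close> to \<open>2, 3\<close> of the next block. Vertex slot \<open>j\<close> of block \<open>i\<close> is the number \<open>8 * i + j\<close>,
  edge slot \<open>j\<close> the number \<open>12 * i + j\<close>.\<close>

definition slot_ends :: "nat \<Rightarrow> nat \<Rightarrow> nat set" where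
  "slot_ends i j =
     (if i = 0 then [{}, {}, {}, {2, 3}, {2, 4}, {3, 4}, {5, 6}, {5, 7}, {6, 7}, {4, 5}]
      else [{0, 2}, {1, 2}, {3, 4}, {3, 5}, {0, 6}, {1, 7}, {4, 6}, {5, 7}, {0, 5}, {1, 4}]) ! j"

definition pair_ends :: "nat \<Rightarrow> nat \<Rightarrow> nat \<Rightarrow> (nat \<times> nat) set" where
  "pair_ends m i j =
     (if j < 10 then Pair i ` slot_ends i j
      else {(i, j - 4), (if Suc i = m then 0 else Suc i, j - 8)})"

definition encode :: "nat \<Rightarrow> nat \<times> nat \<Rightarrow> nat" where
  "encode n p = n * fst p + snd p"

text \<open>The void slots of the hub carry the smallest numbers, so vertices and edges form
  intervals.\<close>

definition ring :: "nat \<Rightarrow> (nat, nat) multigraph" where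
  "ring m = \<lparr>verts = {2..<8 * m}, edges = {3..<12 * m},
     ends = \<lambda>e. encode 8 ` pair_ends m (e div 12) (e mod 12)\<rparr>"

text \<open>Incidence seen from the vertices: explicit stars turn degree and matching conditions
  into finite case checks. \<open>h\<close> is the cyclically preceding block, to which the two
  edges entering block \<open>i\<close> belong. Empty lists stand at the void slots.\<close>

definition pair_star :: "nat \<Rightarrow> nat \<Rightarrow> nat \<Rightarrow> (nat \<times> nat) list" where
  "pair_star m i j = (let h = (if i = 0 then m - 1 else i - 1) in
     (if i = 0
      then [[], [], [(h, 10), (i, 3), (i, 4)], [(h, 11), (i, 3), (i, 5)], [(i, 4), (i, 5), (i, 9)],
        [(i, 6), (i, 7), (i, 9)], [(i, 6), (i, 8), (i, 10)], [(i, 7), (i, 8), (i, 11)]]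
      else [[(i, 0), (i, 4), (i, 8)], [(i, 1), (i, 5), (i, 9)],
        [(h, 10), (i, 0), (i, 1)], [(h, 11), (i, 2), (i, 3)],
        [(i, 2), (i, 6), (i, 9)], [(i, 3), (i, 7), (i, 8)],
        [(i, 4), (i, 6), (i, 10)], [(i, 5), (i, 7), (i, 11)]]) ! j)"

lemma nat_less_8: "(j::nat) < 8 \<longleftrightarrow> j \<in> {0, 1, 2, 3, 4, 5, 6, 7}" by auto

lemma nat_less_12: "(j::nat) < 12 \<longleftrightarrow> j \<in> {0, 1, 2, 3, 4, 5, 6, 7, 8, 9, 10, 11}"
  by (simp, presburger)

lemma encode_eq_iff:
  assumes "snd p < n" "snd q < n"
  shows "encode n p = encode n q \<longleftrightarrow> p = q"
proof
  assume eq: "encode n p = encode n q"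
  have "encode n p div n = fst p" "encode n q div n = fst q" using assms by (auto simp: encode_def)
  then show "p = q" using eq by (simp add: encode_def prod_eq_iff)
qed simp

lemma encode_mem_image_iff:
  assumes "snd p < n" "\<And>q. q \<in> P \<Longrightarrow> snd q < n"
  shows "encode n p \<in> encode n ` P \<longleftrightarrow> p \<in> P"
  using assms encode_eq_iff by blast

definition block_edge :: "nat \<Rightarrow> nat \<Rightarrow> nat \<Rightarrow> bool" where
  "block_edge m k l \<longleftrightarrow> k < m \<and> l < 12 \<and> (k = 0 \<longrightarrow> 3 \<le> l)"

definition block_vert :: "nat \<Rightarrow> nat \<Rightarrow> nat \<Rightarrow> bool" where
  "block_vert m i j \<longleftrightarrow> i < m \<and> j < 8 \<and> (i = 0 \<longrightarrow> 2 \<le> j)"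

lemma ring_edge_cases:
  assumes "e \<in> edges (ring m)"
  obtains k l where "e = encode 12 (k, l)" "block_edge m k l"
proof
  show "e = encode 12 (e div 12, e mod 12)" by (simp add: encode_def)
  show "block_edge m (e div 12) (e mod 12)"
    using assms by (auto simp: block_edge_def ring_def)
qed

lemma ring_vert_cases:
  assumes "v \<in> verts (ring m)"
  obtains i j where "v = encode 8 (i, j)" "block_vert m i j"
proof
  show "v = encode 8 (v div 8, v mod 8)" by (simp add: encode_def)
  show "block_vert m (v div 8) (v mod 8)"
    using assms by (auto simp: block_vert_def ring_def)
qed

lemma encode_edge_mem: "block_edge m k l \<Longrightarrow> encode 12 (k, l) \<in> edges (ring m)"
  by (auto simp: block_edge_def ring_def encode_def)

lemma encode_vert_mem: "block_vert m i j \<Longrightarrow> encode 8 (i, j) \<in> verts (ring m)"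
  by (auto simp: block_vert_def ring_def encode_def)

lemma ends_ring: "l < 12 \<Longrightarrow> ends (ring m) (encode 12 (k, l)) = encode 8 ` pair_ends m k l"
  by (simp add: ring_def encode_def)

lemma block_vert_pair_ends:
  assumes "2 \<le> m" "block_edge m k l" "p \<in> pair_ends m k l"
  shows "block_vert m (fst p) (snd p)"
proof -
  have "l < 12" using assms by (simp add: block_edge_def)
  then show ?thesis
    using assms unfolding nat_less_12
    by (elim insertE emptyE)
      (auto simp: pair_ends_def slot_ends_def block_edge_def block_vert_def split: if_splits)
qed

lemma pair_ends_pair_star:
  assumes "2 \<le> m" "block_vert m i j" "block_edge m k l"
  shows "(i, j) \<in> pair_ends m k l \<longleftrightarrow> (k, l) \<in> set (pair_star m i j)"
proof -
  have "l < 12" "j < 8" using assms by (auto simp: block_edge_def block_vert_def)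
  then show ?thesis
    using assms unfolding nat_less_12 nat_less_8
    by (elim insertE emptyE)
      (simp_all add: pair_ends_def slot_ends_def block_edge_def block_vert_def pair_star_def, auto)
qed

lemma pair_star_eq:
  assumes "2 \<le> m" "block_vert m i j"
  obtains p q r where "pair_star m i j = [p, q, r]" "distinct [p, q, r]"
    "block_edge m (fst p) (snd p)" "block_edge m (fst q) (snd q)" "block_edge m (fst r) (snd r)"
proof -
  have "j < 8" using assms by (auto simp: block_vert_def)
  then have "\<exists>p q r. pair_star m i j = [p, q, r] \<and> distinct [p, q, r] \<and>
    block_edge m (fst p) (snd p) \<and> block_edge m (fst q) (snd q) \<and> block_edge m (fst r) (snd r)"
    using assms unfolding nat_less_8
    by (elim insertE emptyE; cases "i = 0")
      (simp_all add: block_edge_def block_vert_def pair_star_def)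
  then show ?thesis using that by blast
qed

definition exactly_one :: "bool \<Rightarrow> bool \<Rightarrow> bool \<Rightarrow> bool" where
  "exactly_one a b c \<longleftrightarrow> (a \<and> \<not> b \<and> \<not> c) \<or> (\<not> a \<and> b \<and> \<not> c) \<or> (\<not> a \<and> \<not> b \<and> c)"

lemma card_filter_three_eq_1:
  assumes "distinct [p, q, r]"
  shows "card {x\<in>set [p, q, r]. P x} = 1 \<longleftrightarrow> exactly_one (P p) (P q) (P r)"
proof -
  have "{x\<in>set [p, q, r]. P x} =
    (if P p then {p} else {}) \<union> (if P q then {q} else {}) \<union> (if P r then {r} else {})"
    by auto
  then show ?thesis using assms by (auto simp: exactly_one_def card_insert_if)
qed

text \<open>Indices below \<open>12\<close> are the edge slots of a Petersen block, \<open>12\<close> and \<open>13\<close> the two edges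
  entering it from the previous block. If the latter had different colours, the colouring would
  extend to one of the whole Petersen graph.\<close>

lemma petersen_inputs_same_colour:
  fixes A B C :: "nat \<Rightarrow> bool"
  assumes one: "\<And>P. P \<in> {A, B, C} \<Longrightarrow>
      exactly_one (P 0) (P 4) (P 8) \<and> exactly_one (P 1) (P 5) (P 9) \<and>
      exactly_one (P 12) (P 0) (P 1) \<and> exactly_one (P 13) (P 2) (P 3) \<and>
      exactly_one (P 2) (P 6) (P 9) \<and> exactly_one (P 3) (P 7) (P 8) \<and>
      exactly_one (P 4) (P 6) (P 10) \<and> exactly_one (P 5) (P 7) (P 11)"
    and cover: "\<And>x. x < 14 \<Longrightarrow> A x \<or> B x \<or> C x"
  shows "A 12 \<longleftrightarrow> A 13"
  \<comment> \<open>At each of the eight vertices the matchings choose one edge each and together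
    cover all three, so every edge lies in exactly one of them. What remains is
    propositional.\<close>
  using one[of A] one[of B] one[of C]
    cover[of 0] cover[of 1] cover[of 2] cover[of 3] cover[of 4] cover[of 5] cover[of 6]
    cover[of 7] cover[of 8] cover[of 9] cover[of 10] cover[of 11] cover[of 12] cover[of 13]
  unfolding exactly_one_def by (simp, argo)

section \<open>The ring as a simple cubic graph\<close>

lemma card_pair_ends:
  assumes "block_edge m k l"
  shows "card (pair_ends m k l) = 2"
proof -
  have "l < 12" using assms by (simp add: block_edge_def)
  then show ?thesis
    using assms unfolding nat_less_12
    by (elim insertE emptyE) (auto simp: pair_ends_def slot_ends_def block_edge_def)
qed

lemma inj_pair_ends:
  assumes "2 \<le> m" "block_edge m k l" "block_edge m k' l'" "pair_ends m k l = pair_ends m k' l'"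
  shows "k = k' \<and> l = l'"
proof -
  have "l < 12" "l' < 12" using assms by (simp_all add: block_edge_def)
  then show ?thesis
    using assms unfolding nat_less_12
    by (elim insertE emptyE)
       (simp_all add: pair_ends_def slot_ends_def block_edge_def doubleton_eq_iff split: if_splits)
qed

lemma
  assumes "2 \<le> m"
  shows finite_multigraph_ring: "finite_multigraph (ring m)"
    and card_ends_ring: "e \<in> edges (ring m) \<Longrightarrow> card (ends (ring m) e) = 2"
proof -
  have *: "ends (ring m) e \<subseteq> verts (ring m) \<and> card (ends (ring m) e) = 2"
    if "e \<in> edges (ring m)" for e
    using that
  proof (cases rule: ring_edge_cases)
    case (1 k l)
    then have "l < 12" by (simp add: block_edge_def)
    have ends: "ends (ring m) e = encode 8 ` pair_ends m k l"
      using 1 \<open>l < 12\<close> ends_ring by simp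
    have bv: "block_vert m (fst p) (snd p)" if "p \<in> pair_ends m k l" for p
      using block_vert_pair_ends[OF assms 1(2) that] .
    have "inj_on (encode 8) (pair_ends m k l)"
      by (rule inj_onI) (use bv encode_eq_iff in \<open>auto simp: block_vert_def\<close>)
    then have "card (ends (ring m) e) = 2"
      using card_pair_ends[OF 1(2)] by (simp add: ends card_image)
    moreover have "ends (ring m) e \<subseteq> verts (ring m)"
      using bv encode_vert_mem by (fastforce simp: ends)
    ultimately show ?thesis by simp
  qed
  then show "finite_multigraph (ring m)"
    by (simp add: finite_multigraph_def) (simp add: ring_def)
  show "e \<in> edges (ring m) \<Longrightarrow> card (ends (ring m) e) = 2"
    using * by blast
qed

lemma encode_vert_mem_ends_iff:
  assumes "2 \<le> m" "block_vert m i j" "block_edge m k l"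
  shows "encode 8 (i, j) \<in> ends (ring m) (encode 12 (k, l)) \<longleftrightarrow> (i, j) \<in> pair_ends m k l"
proof -
  have "l < 12" "j < 8" using assms by (auto simp: block_edge_def block_vert_def)
  then show ?thesis
    using block_vert_pair_ends[OF assms(1,3)]
    by (subst ends_ring) (auto simp: block_vert_def intro!: encode_mem_image_iff)
qed

lemma inj_on_ends_ring:
  assumes "2 \<le> m"
  shows "inj_on (ends (ring m)) (edges (ring m))"
proof (rule inj_onI)
  fix e f assume ef: "e \<in> edges (ring m)" "f \<in> edges (ring m)" "ends (ring m) e = ends (ring m) f"
  obtain k l where e: "e = encode 12 (k, l)" "block_edge m k l" using ef(1) by (rule ring_edge_cases)
  obtain k' l' where f: "f = encode 12 (k', l')" "block_edge m k' l'"
    using ef(2) by (rule ring_edge_cases)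
  have "p \<in> pair_ends m k l \<longleftrightarrow> p \<in> pair_ends m k' l'" for p
    using encode_vert_mem_ends_iff[OF assms _ e(2), of "fst p" "snd p"]
      encode_vert_mem_ends_iff[OF assms _ f(2), of "fst p" "snd p"]
      block_vert_pair_ends[OF assms e(2), of p] block_vert_pair_ends[OF assms f(2), of p] ef(3) e f
    by auto
  then have "pair_ends m k l = pair_ends m k' l'" by blast
  then show "e = f" using inj_pair_ends[OF assms e(2) f(2)] e f by simp
qed

lemma degree_in_ring:
  assumes m: "2 \<le> m" and F: "F \<subseteq> edges (ring m)" and v: "block_vert m i j"
  shows "degree_in (ring m) F (encode 8 (i, j)) = card {p\<in>set (pair_star m i j). encode 12 p \<in> F}"
proof -
  have star: "block_edge m (fst p) (snd p)" if "p \<in> set (pair_star m i j)" for p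
    using pair_star_eq[OF m v] that by (metis (no_types, lifting) empty_iff empty_set insert_iff list.simps(15))
  have "{e\<in>F. encode 8 (i, j) \<in> ends (ring m) e} = encode 12 ` {p\<in>set (pair_star m i j). encode 12 p \<in> F}"
    (is "?L = ?R")
  proof (intro set_eqI iffI)
    fix e assume e: "e \<in> ?L"
    then obtain k l where kl: "e = encode 12 (k, l)" "block_edge m k l"
      using F ring_edge_cases by blast
    then show "e \<in> ?R"
      using e encode_vert_mem_ends_iff[OF m v kl(2)] pair_ends_pair_star[OF m v kl(2)] by auto
  next
    fix e assume "e \<in> ?R"
    then obtain p where p: "e = encode 12 p" "p \<in> set (pair_star m i j)" "encode 12 p \<in> F" by blast
    then show "e \<in> ?L"
      using encode_vert_mem_ends_iff[OF m v star[OF p(2)]] pair_ends_pair_star[OF m v star[OF p(2)]]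
      by simp
  qed
  moreover have "inj_on (encode 12) {p\<in>set (pair_star m i j). encode 12 p \<in> F}"
    by (rule inj_onI) (use star encode_eq_iff in \<open>auto simp: block_edge_def\<close>)
  ultimately show ?thesis
    using F card_ends_ring[OF m]
    by (subst degree_in_loopless) (auto simp: card_image)
qed

lemma cubic_ring:
  assumes "2 \<le> m"
  shows "cubic (ring m)"
  unfolding cubic_def
proof
  fix v assume "v \<in> verts (ring m)"
  then obtain i j where v: "v = encode 8 (i, j)" "block_vert m i j" by (rule ring_vert_cases)
  obtain p q r where pqr: "pair_star m i j = [p, q, r]" "distinct [p, q, r]"
    "block_edge m (fst p) (snd p)" "block_edge m (fst q) (snd q)" "block_edge m (fst r) (snd r)"
    using pair_star_eq[OF assms v(2)] .
  then have "{x\<in>set (pair_star m i j). encode 12 x \<in> edges (ring m)} = {p, q, r}"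
    using encode_edge_mem by fastforce
  then show "degree_in (ring m) (edges (ring m)) v = 3"
    using degree_in_ring[OF assms order_refl v(2)] v pqr by simp
qed

lemma perfect_matching_ring_iff:
  assumes "2 \<le> m" "M \<subseteq> edges (ring m)"
  shows "perfect_matching (ring m) M \<longleftrightarrow> (\<forall>i j. block_vert m i j \<longrightarrow>
    card {p\<in>set (pair_star m i j). encode 12 p \<in> M} = 1)"
proof -
  have "(\<forall>v\<in>verts (ring m). degree_in (ring m) M v = 1) \<longleftrightarrow>
    (\<forall>i j. block_vert m i j \<longrightarrow> degree_in (ring m) M (encode 8 (i, j)) = 1)"
    by (blast intro: encode_vert_mem elim: ring_vert_cases)
  then show ?thesis using assms(2) by (simp add: perfect_matching_def degree_in_ring[OF assms])
qed

section \<open>Periodic matchings and the two witnessing arrays\<close>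

text \<open>One pattern \<open>P\<close> of edge slots is repeated in all Petersen blocks, with
  \<open>H\<close> on the hub. To fit together around the ring, the patterns used below agree on the
  linking slots \<open>10\<close> and \<open>11\<close>.\<close>

definition periodic :: "nat \<Rightarrow> nat set \<Rightarrow> nat set \<Rightarrow> nat set" where
  "periodic m H P = {e\<in>edges (ring m). e mod 12 \<in> (if e div 12 = 0 then H else P)}"

lemma encode_mem_periodic:
  assumes "block_edge m k l"
  shows "encode 12 (k, l) \<in> periodic m H P \<longleftrightarrow> l \<in> (if k = 0 then H else P)"
  using assms encode_edge_mem[OF assms] by (simp add: periodic_def encode_def block_edge_def)

lemma perfect_matching_periodic:
  assumes m: "2 \<le> m" and HP: "(H, P) \<in> {({3, 8, 9}, {0, 3, 5, 6}), ({3, 8, 9}, {1, 2, 4, 7}),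
    ({5, 7, 10}, {2, 5, 8, 10}), ({9, 10, 11}, {8, 9, 10, 11})}"
  shows "perfect_matching (ring m) (periodic m H P)"
proof -
  define sel where "sel x \<longleftrightarrow> snd x \<in> (if fst x = 0 then H else P)" for x :: "nat \<times> nat"
  have "card {p\<in>set (pair_star m i j). encode 12 p \<in> periodic m H P} = 1" if v: "block_vert m i j" for i j
  proof -
    obtain p q r where pqr: "pair_star m i j = [p, q, r]" "distinct [p, q, r]"
      "block_edge m (fst p) (snd p)" "block_edge m (fst q) (snd q)" "block_edge m (fst r) (snd r)"
      using pair_star_eq[OF m v] .
    have mem: "encode 12 x \<in> periodic m H P \<longleftrightarrow> sel x"
      if "x \<in> {p, q, r}" for x
      using that pqr encode_mem_periodic[of m "fst x" "snd x"] by (auto simp: sel_def)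
    have "j < 8" using v by (simp add: block_vert_def)
    \<comment> \<open>Periodicity leaves three kinds of block to check: the hub, block
      \<open>1\<close>, whose entering edges follow the pattern \<open>H\<close>, and the later
      blocks, whose entering edges follow \<open>P\<close>.\<close>
    then have "exactly_one (sel (pair_star m i j ! 0)) (sel (pair_star m i j ! 1)) (sel (pair_star m i j ! 2))"
      using v m HP unfolding nat_less_8
      by (elim insertE emptyE Pair_inject; cases "i = 0"; cases "i = 1")
        (simp_all add: pair_star_def block_vert_def exactly_one_def sel_def)
    then have "exactly_one (sel p) (sel q) (sel r)" by (simp add: pqr(1))
    then show ?thesis
      using pqr mem card_filter_three_eq_1[OF pqr(2), of "\<lambda>x. encode 12 x \<in> periodic m H P"] by simp
  qed
  then show ?thesis using m by (subst perfect_matching_ring_iff) (auto simp: periodic_def)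
qed

text \<open>The first two patterns are disjoint on the Petersen blocks, and on the hub the third is
  disjoint from both.\<close>

lemma regular_three_array_ring:
  assumes "2 \<le> m"
  shows "regular_three_array (ring m) (periodic m {3, 8, 9} {0, 3, 5, 6})
    (periodic m {3, 8, 9} {1, 2, 4, 7}) (periodic m {5, 7, 10} {2, 5, 8, 10})"
  unfolding regular_three_array_def three_array_def
proof (intro conjI perfect_matching_periodic assms)
  show "periodic m {3, 8, 9} {0, 3, 5, 6} \<inter> periodic m {3, 8, 9} {1, 2, 4, 7} \<inter>
    periodic m {5, 7, 10} {2, 5, 8, 10} = {}"
  proof (rule equals0I)
    fix e assume e: "e \<in> periodic m {3, 8, 9} {0, 3, 5, 6} \<inter> periodic m {3, 8, 9} {1, 2, 4, 7} \<inter>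
      periodic m {5, 7, 10} {2, 5, 8, 10}"
    then have "e \<in> edges (ring m)" by (simp add: periodic_def)
    then obtain k l where "e = encode 12 (k, l)" "block_edge m k l" by (rule ring_edge_cases)
    then show False using e by (cases "k = 0") (auto simp: encode_mem_periodic)
  qed
qed simp_all

text \<open>On a Petersen block the three patterns partition the slots \<open>0\<close> to
  \<open>11\<close>, giving a 3-edge-colouring in which both entering edges have the first colour.
  On the hub, slot \<open>9\<close> is covered three times and its four neighbours, slots
  \<open>4\<close> to \<open>7\<close>, are missed; in block \<open>0\<close> slots and edge numbers
  coincide.\<close>

lemma
  assumes "2 \<le> m"
  shows irregular_three_array_ring: "three_array (ring m) (periodic m {9, 10, 11} {8, 9, 10, 11})
     (periodic m {3, 8, 9} {0, 3, 5, 6}) (periodic m {3, 8, 9} {1, 2, 4, 7})"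
    and uncovered_irregular_ring: "uncovered (ring m) (periodic m {9, 10, 11} {8, 9, 10, 11})
     (periodic m {3, 8, 9} {0, 3, 5, 6}) (periodic m {3, 8, 9} {1, 2, 4, 7}) = {4, 5, 6, 7}"
    (is "?U = _")
proof -
  show "three_array (ring m) (periodic m {9, 10, 11} {8, 9, 10, 11})
     (periodic m {3, 8, 9} {0, 3, 5, 6}) (periodic m {3, 8, 9} {1, 2, 4, 7})"
    unfolding three_array_def by (intro conjI perfect_matching_periodic assms) simp_all
  show "?U = {4, 5, 6, 7}"
  proof (rule set_eqI)
    fix e
    show "e \<in> ?U \<longleftrightarrow> e \<in> {4, 5, 6, 7}"
    proof (cases "e \<in> edges (ring m)")
      case True
      then obtain k l where e: "e = encode 12 (k, l)" "block_edge m k l" by (rule ring_edge_cases)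
      then have "l < 12" by (simp add: block_edge_def)
      then show ?thesis
        using True e unfolding nat_less_12
        by (elim insertE emptyE; cases "k = 0")
          (simp_all add: uncovered_def encode_mem_periodic, simp_all add: encode_def block_edge_def)
    next
      case False
      then show ?thesis using assms by (auto simp: uncovered_def ring_def)
    qed
  qed
qed

section \<open>The 3-edge-cuts through the hub edge and the lower bound\<close>

text \<open>The interval consists of the hub triangle \<open>5, 6, 7\<close> and the blocks
  \<open>1\<close> to \<open>i - 1\<close>. It is left only through the edge joining the two
  triangles and through the two edges entering block \<open>i\<close>.\<close>

lemma cut_ring:
  assumes "2 \<le> m" "0 < i" "i < m"
  shows "cut (ring m) {5..<8 * i} = {encode 12 (0, 9), encode 12 (i - 1, 10), encode 12 (i - 1, 11)}"
    (is "?C = ?R")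
proof (rule set_eqI)
  fix e
  show "e \<in> ?C \<longleftrightarrow> e \<in> ?R"
  proof (cases "e \<in> edges (ring m)")
    case True
    then obtain k l where e: "e = encode 12 (k, l)" "block_edge m k l" by (rule ring_edge_cases)
    then have l: "l < 12" by (simp add: block_edge_def)
    \<comment> \<open>Membership in the interval, expressed in block coordinates.\<close>
    define inside where "inside p \<longleftrightarrow> (fst p = 0 \<longrightarrow> 5 \<le> snd p) \<and> fst p < i" for p :: "nat \<times> nat"
    have "encode 8 p \<in> {5..<8 * i} \<longleftrightarrow> inside p" if "p \<in> pair_ends m k l" for p
    proof -
      have "snd p < 8" using block_vert_pair_ends[OF assms(1) e(2) that] by (simp add: block_vert_def)
      then show ?thesis using assms(2) by (auto simp: inside_def encode_def)
    qed
    then have "e \<in> ?C \<longleftrightarrow> (\<exists>p\<in>pair_ends m k l. inside p) \<and> (\<exists>p\<in>pair_ends m k l. \<not> inside p)"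
      using True e l by (auto simp: cut_def ends_ring)
    also have "\<dots> \<longleftrightarrow> (k, l) \<in> {(0, 9), (i - 1, 10), (i - 1, 11)}"
      using l e(2) assms unfolding nat_less_12
      by (elim insertE emptyE; cases "k = 0")
        (auto simp: pair_ends_def slot_ends_def block_edge_def inside_def)
    also have "\<dots> \<longleftrightarrow> e \<in> ?R"
      using l by (simp add: e(1) encode_eq_iff)
    finally show ?thesis .
  next
    case False
    moreover have "?R \<subseteq> edges (ring m)"
      using assms by (auto intro!: encode_edge_mem simp: block_edge_def)
    ultimately show ?thesis by (auto simp: cut_def)
  qed
qed

text \<open>\<open>M\<close> meets the 3-edge-cut in an odd number of edges, of which the two
  entering edges supply none or two.\<close>

lemma perfect_matching_hub_edge:
  assumes "2 \<le> m" "0 < i" "i < m" "perfect_matching (ring m) M"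
    and same: "encode 12 (i - 1, 10) \<in> M \<longleftrightarrow> encode 12 (i - 1, 11) \<in> M"
  shows "encode 12 (0, 9) \<in> M"
proof (rule ccontr)
  assume notin: "encode 12 (0, 9) \<notin> M"
  define a b where "a = encode 12 (i - 1, 10)" and "b = encode 12 (i - 1, 11)"
  have ab: "a \<noteq> b" "encode 12 (0, 9) \<noteq> a" "encode 12 (0, 9) \<noteq> b" by (simp_all add: a_def b_def encode_eq_iff)
  have C: "cut (ring m) {5..<8 * i} = {encode 12 (0, 9), a, b}"
    using cut_ring[OF assms(1-3)] by (simp add: a_def b_def)
  have "{5..<8 * i} \<subseteq> verts (ring m)" using assms by (auto simp: ring_def)
  then have "odd (card ({encode 12 (0, 9), a, b} \<inter> M))"
    using cubic_matching_cut_parity[OF finite_multigraph_ring[OF assms(1)] cubic_ring[OF assms(1)] assms(4)] C ab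
    by (metis card_3_iff odd_numeral)
  moreover have "a \<in> M \<longleftrightarrow> b \<in> M" using same by (simp add: a_def b_def)
  ultimately show False using notin ab by (cases "b \<in> M") auto
qed

lemma exactly_one_star:
  assumes "2 \<le> m" "perfect_matching (ring m) M" "block_vert m i j" "pair_star m i j = [p, q, r]"
  shows "exactly_one (encode 12 p \<in> M) (encode 12 q \<in> M) (encode 12 r \<in> M)"
proof -
  have "M \<subseteq> edges (ring m)" using assms by (simp add: perfect_matching_def)
  then have "card {x\<in>set [p, q, r]. encode 12 x \<in> M} = 1"
    using perfect_matching_ring_iff[OF assms(1), THEN iffD1, OF _ assms(2), rule_format, OF _ assms(3)]
      assms(4) by simp
  moreover have "distinct [p, q, r]" 
    by (rule pair_star_eq[OF assms(1,3)]) (use assms(4) in simp)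
  ultimately show ?thesis by (simp only: card_filter_three_eq_1)
qed

text \<open>The two blocks in the conclusion arise because the edges entering block \<open>i\<close>
  are numbered in block \<open>i - 1\<close>.\<close>

lemma regular_block_uncovered:
  assumes m: "2 \<le> m" and i: "0 < i" "i < m" and reg: "regular_three_array (ring m) M1 M2 M3"
  shows "\<exists>e\<in>uncovered (ring m) M1 M2 M3. e div 12 = i - 1 \<or> e div 12 = i"
proof (rule ccontr)
  assume none: "\<not> ?thesis"
  \<comment> \<open>Translates the indices of \<open>petersen_inputs_same_colour\<close>:
    \<open>12\<close> and \<open>13\<close> become slots \<open>10\<close> and \<open>11\<close> of
    the preceding block.\<close>
  define g where "g x = (if x < 12 then encode 12 (i, x) else encode 12 (i - 1, x - 2))" for x :: nat
  have M: "perfect_matching (ring m) M1" "perfect_matching (ring m) M2" "perfect_matching (ring m) M3"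
    using reg by (auto simp: regular_three_array_def three_array_def)
  have cover: "g x \<in> M1 \<or> g x \<in> M2 \<or> g x \<in> M3" if "x < 14" for x
  proof -
    have "g x \<in> edges (ring m)"
      using that i by (auto simp: g_def block_edge_def intro!: encode_edge_mem)
    moreover have "g x div 12 = i - 1 \<or> g x div 12 = i" using that by (auto simp: g_def encode_def)
    ultimately show ?thesis using none by (auto simp: uncovered_def)
  qed
  have one: "exactly_one (g 0 \<in> M) (g 4 \<in> M) (g 8 \<in> M) \<and> exactly_one (g 1 \<in> M) (g 5 \<in> M) (g 9 \<in> M) \<and>
      exactly_one (g 12 \<in> M) (g 0 \<in> M) (g 1 \<in> M) \<and> exactly_one (g 13 \<in> M) (g 2 \<in> M) (g 3 \<in> M) \<and>
      exactly_one (g 2 \<in> M) (g 6 \<in> M) (g 9 \<in> M) \<and> exactly_one (g 3 \<in> M) (g 7 \<in> M) (g 8 \<in> M) \<and>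
      exactly_one (g 4 \<in> M) (g 6 \<in> M) (g 10 \<in> M) \<and> exactly_one (g 5 \<in> M) (g 7 \<in> M) (g 11 \<in> M)"
    if "perfect_matching (ring m) M" for M
  proof -
    have star: "exactly_one (encode 12 p \<in> M) (encode 12 q \<in> M) (encode 12 r \<in> M)"
      if "pair_star m i j = [p, q, r]" "j < 8" for j p q r
      using exactly_one_star[OF m \<open>perfect_matching (ring m) M\<close> _ that(1)] that(2) i
      by (simp add: block_vert_def)
    show ?thesis
      using i star[of 0 "(i, 0)" "(i, 4)" "(i, 8)"] star[of 1 "(i, 1)" "(i, 5)" "(i, 9)"]
        star[of 2 "(i - 1, 10)" "(i, 0)" "(i, 1)"] star[of 3 "(i - 1, 11)" "(i, 2)" "(i, 3)"]
        star[of 4 "(i, 2)" "(i, 6)" "(i, 9)"] star[of 5 "(i, 3)" "(i, 7)" "(i, 8)"]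
        star[of 6 "(i, 4)" "(i, 6)" "(i, 10)"] star[of 7 "(i, 5)" "(i, 7)" "(i, 11)"]
      by (simp add: pair_star_def g_def)
  qed
  \<comment> \<open>The colouring lemma speaks of its first matching only; an arbitrary order allows
    each of the three to be put first.\<close>
  have same: "g 12 \<in> A \<longleftrightarrow> g 13 \<in> A"
    if pm: "perfect_matching (ring m) A" "perfect_matching (ring m) B" "perfect_matching (ring m) C"
      and cov: "\<And>x. x < 14 \<Longrightarrow> g x \<in> A \<or> g x \<in> B \<or> g x \<in> C" for A B C
  proof (rule petersen_inputs_same_colour[of "\<lambda>x. g x \<in> A" "\<lambda>x. g x \<in> B" "\<lambda>x. g x \<in> C"])
    fix P assume "P \<in> {\<lambda>x. g x \<in> A, \<lambda>x. g x \<in> B, \<lambda>x. g x \<in> C}"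
    then obtain M where "P = (\<lambda>x. g x \<in> M)" "perfect_matching (ring m) M" using pm by blast
    then show "exactly_one (P 0) (P 4) (P 8) \<and> exactly_one (P 1) (P 5) (P 9) \<and>
      exactly_one (P 12) (P 0) (P 1) \<and> exactly_one (P 13) (P 2) (P 3) \<and>
      exactly_one (P 2) (P 6) (P 9) \<and> exactly_one (P 3) (P 7) (P 8) \<and>
      exactly_one (P 4) (P 6) (P 10) \<and> exactly_one (P 5) (P 7) (P 11)"
      using one[of M] by simp
  qed (rule cov)
  have "encode 12 (0, 9) \<in> A" if "g 12 \<in> A \<longleftrightarrow> g 13 \<in> A" "perfect_matching (ring m) A" for A
    using that by (intro perfect_matching_hub_edge[OF m i]) (simp_all add: g_def)
  then have "encode 12 (0, 9) \<in> M1 \<inter> M2 \<inter> M3"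
    using same[of M1 M2 M3] same[of M2 M1 M3] same[of M3 M1 M2] M cover by blast
  then show False using reg by (auto simp: regular_three_array_def)
qed

text \<open>The uncovered edge found at an odd block \<open>2 * k + 1\<close> lies in the block pair
  \<open>2 * k\<close>, \<open>2 * k + 1\<close>. These \<open>d\<close> pairs are disjoint, and
  \<open>e div 24\<close> recovers \<open>k\<close>, so the edges are distinct.\<close>

lemma regular_uncovered_ring:
  assumes "regular_three_array (ring (2 * d)) M1 M2 M3" "1 \<le> d"
  shows "d \<le> card (uncovered (ring (2 * d)) M1 M2 M3)" (is "_ \<le> card ?U")
proof -
  have "{..<d} \<subseteq> (\<lambda>e. e div 24) ` ?U"
  proof
    fix k assume "k \<in> {..<d}"
    then obtain e where "e \<in> ?U" and e: "e div 12 = 2 * k \<or> e div 12 = 2 * k + 1"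
      using regular_block_uncovered[of "2 * d" "2 * k + 1", OF _ _ _ assms(1)] assms(2) by auto
    have "e div 24 = (e div 12) div 2" by (simp flip: div_mult2_eq)
    then show "k \<in> (\<lambda>e. e div 24) ` ?U" using \<open>e \<in> ?U\<close> e by auto
  qed
  moreover have "finite ?U" by (simp add: uncovered_def ring_def)
  ultimately show ?thesis by (metis card_lessThan surj_card_le)
qed

section \<open>Both minima for the ring with \<open>2 * d\<close> blocks\<close>

theorem theorem1p1:
  fixes d :: nat
  assumes "d \<ge> 4"
  shows "\<exists>G :: (nat, nat) multigraph.
    finite_multigraph G \<and> cubic G \<and> bridgeless G \<and>
    defect G = 4 \<and>
    (\<exists>M1 M2 M3. regular_three_array G M1 M2 M3) \<and> regular_defect G \<ge> d"
proof -
  define G where "G = ring (2 * d)"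
  have m: "2 \<le> 2 * d" using assms by simp
  note fin = finite_multigraph_ring[OF m, folded G_def]
    and two = card_ends_ring[OF m, folded G_def] and cub = cubic_ring[OF m, folded G_def]
  note reg = regular_three_array_ring[OF m, folded G_def]
  note irr = irregular_three_array_ring[OF m, folded G_def] uncovered_irregular_ring[OF m, folded G_def]
  have reg_bound: "d \<le> card (uncovered G M1 M2 M3)" if "regular_three_array G M1 M2 M3" for M1 M2 M3
    using regular_uncovered_ring[of d] that assms by (simp add: G_def)
  \<comment> \<open>\<open>Min\<close> is meaningful only on finite sets; a general \<open>P\<close>
    serves both minima.\<close>
  have finU: "finite {card (uncovered G M1 M2 M3) | M1 M2 M3. P M1 M2 M3}" for P
  proof (rule finite_subset)
    show "{card (uncovered G M1 M2 M3) | M1 M2 M3. P M1 M2 M3} \<subseteq> {..card (edges G)}"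
      using fin by (auto simp: finite_multigraph_def uncovered_def intro!: card_mono)
  qed simp
  have "defect G = 4"
    unfolding defect_def
  proof (rule Min_eqI[OF finU])
    fix c assume "c \<in> {card (uncovered G M1 M2 M3) | M1 M2 M3. three_array G M1 M2 M3}"
    then obtain M1 M2 M3 where c: "c = card (uncovered G M1 M2 M3)" "three_array G M1 M2 M3" by blast
    show "4 \<le> c"
    proof (cases "M1 \<inter> M2 \<inter> M3 = {}")
      case True
      \<comment> \<open>A regular array already misses at least \<open>d\<close> edges, and
        \<open>d\<close> is at least 4.\<close>
      then show ?thesis using reg_bound[of M1 M2 M3] c assms by (simp add: regular_three_array_def)
    next
      case False
      then show ?thesis
        using irregular_three_array_uncovered[OF fin cub two _ c(2)]
          inj_on_ends_ring[OF m] c by (simp add: G_def)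
    qed
  next
    show "4 \<in> {card (uncovered G M1 M2 M3) | M1 M2 M3. three_array G M1 M2 M3}"
      by (rule CollectI, intro exI conjI, rule sym, subst irr(2), simp, rule irr(1))
  qed
  moreover have "d \<le> regular_defect G"
    unfolding regular_defect_def
    \<comment> \<open>The array \<open>reg\<close> makes the set of values nonempty, so that its
      \<open>Min\<close> is attained.\<close>
    using reg reg_bound by (subst Min_ge_iff[OF finU]) blast+
  ultimately show ?thesis
    using fin cub bridgeless_if_regular_three_array[OF fin cub reg] reg by blast
qed

end
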